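(* Consider the discrete-time online-learning tracking setting: for $n\in\mathbb N_0$, states $x_n\in\mathbb R^d$, reference $\xi_n\in\mathbb R^d$, tracking error $e_n=\xi_n-x_n$ with error dynamics $$e_{n+1}=M e_n+\Delta\,F_n(x_n),\qquad F_n:=f-\hat f_n,$$ where $\Delta>0$, $M\in\mathbb R^{d\times d}$, $f:\mathbb R^d\to\mathbb R^d$ is a continuous function that is $L^*$-$\alpha$-Hölder up to error $\bar E_h\in\mathbb R_{\geq 0}$, the observations $\tilde f$ satisfy $\|\tilde f(x)-f(x)\|_\infty\le\bar{\mathfrak e}$ for all $x$, and $\hat f_n$ is the LACKI predictor based on $\mathcal D_n$ with $\mathcal D_{n+1}=\mathcal D_n\cup\{(x_n,\tilde f(x_n))\}$ for all $n$. Assume that, for some $q\ge0$, the LACKI parameter is $\lambda=2\bar{\mathfrak e}+q$, and that the sequence $(F_n(x_n))_{n}$ and the reference $(\xi_n)_n$ are bounded. If the initial innovation function is bounded, i.e. there is $b\in\mathbb R$ with $\|F_0(x)\|_\infty\le b$ for all $x$, and if $M$ is stable, i.e. its spectral radius satisfies $\rho(M)<1$, then the tracking error converges as follows: $$\|e_n\|_\infty\xrightarrow{n\to\infty}\Big[0,\ \sigma\big(\tfrac q2+2\bar{\mathfrak e}+2\bar E_h\big)\Big],\qquad \sigma:=\Delta\sum_{i=0}^\infty |||M^i|||<\infty,$$ where $|||\cdot|||=\sqrt d\,\|\cdot\|_2$ ($\|\cdot\|_2$ the spectral norm).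
   Context: Convergence to a set: a real sequence $(a_n)$ converges to $S\subset\mathbb R$ if $\inf_{y\in S}|y-a_n|\to0$. The transition matrix is $M=\begin{pmatrix} I_k&\Delta I_k\\ -\Delta K_1& I_k-\Delta K_2\end{pmatrix}$ with $k=d/2$ ($d$ even) and gain matrices $K_1,K_2\in\mathbb R^{k\times k}$ chosen by the designer. Input space $\mathbb R^d$ has metric $\mathfrak d(x,x')=\|x-x'\|$ for some norm on $\mathbb R^d$; output space $\mathbb R^d$ has metric $\|y-y'\|_\infty$. A continuous function $f$ is $L^*$-$\alpha$-Hölder up to error $\bar E_h$ if $f=\phi+\psi$ with $\|\phi(x)-\phi(x')\|_\infty\le L^*\mathfrak d(x,x')^\alpha$ for all $x,x'$ and $\sup_x\|\psi(x)\|_\infty\le\bar E_h$. LACKI predictor. $\mathcal D_0$ is a finite nonempty data set of pairs $(s,\tilde f(s))$. Write $\mathcal D_n=\{(s_i,\tilde f_i):i=1,\dots,N_n\}$, $\tilde f_i=\tilde f(s_i)$, $G_n=\{s_1,\dots,s_{N_n}\}$. For $\alpha\in(0,1]$, $\lambda\ge0$, $\underline L\ge0$ set $$L(n):=\max\Big\{\underline L,\ \max_{s,s'\in G_n,\ \mathfrak d(s,s')>0}\frac{\|\tilde f(s)-\tilde f(s')\|_\infty-\lambda}{\mathfrak d(s,s')^\alpha}\Big\}$$ (the inner maximum is omitted if there are no such pairs) and, for a fixed function $e:\mathbb R^d\to\mathbb R_{\ge0}$ and each output component $j$, $$\hat f_{n,j}(x)=\tfrac12\min_{i}\big(\tilde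 f_{i,j}+L(n)\mathfrak d(x,s_i)^\alpha+e(x)\big)+\tfrac12\max_{i}\big(\tilde f_{i,j}-L(n)\mathfrak d(x,s_i)^\alpha-e(x)\big).$$ *)

theory Defs
  imports "HOL-Analysis.Analysis"
begin

definition converges_to_set :: "(nat \<Rightarrow> real) \<Rightarrow> real set \<Rightarrow> bool" where
  "converges_to_set a S \<longleftrightarrow> (\<lambda>n. INF y\<in>S. \<bar>y - a n\<bar>) \<longlonglongrightarrow> 0"

(* An arbitrary norm on R^d, distinct in general from the Euclidean norm of the type class. *)
definition is_norm :: "('a::real_vector \<Rightarrow> real) \<Rightarrow> bool" where
  "is_norm N \<longleftrightarrow>
     (\<forall>x. 0 \<le> N x) \<and> (\<forall>x. N x = 0 \<longleftrightarrow> x = 0) \<and>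
     (\<forall>c x. N (c *\<^sub>R x) = \<bar>c\<bar> * N x) \<and> (\<forall>x y. N (x + y) \<le> N x + N y)"

(* The input metric is N (x - x'); powr gives 0 powr \<alpha> = 0, as needed at x = x'. *)
definition holder_up_to_error ::
    "(real ^ 'n \<Rightarrow> real) \<Rightarrow> real \<Rightarrow> real \<Rightarrow> real \<Rightarrow> (real ^ 'n \<Rightarrow> real ^ 'n) \<Rightarrow> bool" where
  "holder_up_to_error N L \<alpha> E f \<longleftrightarrow>
     (\<exists>\<phi> \<psi>. (\<forall>x. f x = \<phi> x + \<psi> x) \<and>
            (\<forall>x x'. infnorm (\<phi> x - \<phi> x') \<le> L * N (x - x') powr \<alpha>) \<and>
            (\<forall>x. infnorm (\<psi> x) \<le> E))"

definition lacki_const ::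
    "(real ^ 'n \<Rightarrow> real) \<Rightarrow> real \<Rightarrow> real \<Rightarrow> real \<Rightarrow> ((real ^ 'n) \<times> (real ^ 'n)) set \<Rightarrow> real" where
  "lacki_const N \<alpha> lam Lmin D =
     Max (insert Lmin
       {(infnorm (y - y') - lam) / N (s - s') powr \<alpha> | s y s' y'.
          (s, y) \<in> D \<and> (s', y') \<in> D \<and> N (s - s') > 0})"

(* D is a data set of pairs (input, observed output); \<eta> is the function called e in
   the predictor formula, renamed to keep it apart from the tracking error. *)
definition lacki_predictor ::
    "(real ^ 'n \<Rightarrow> real) \<Rightarrow> real \<Rightarrow> real \<Rightarrow> real \<Rightarrow> (real ^ 'n \<Rightarrow> real) \<Rightarrow>
     ((real ^ 'n) \<times> (real ^ 'n)) set \<Rightarrow> real ^ 'n \<Rightarrow> real ^ 'n" where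
  "lacki_predictor N \<alpha> lam Lmin \<eta> D x =
     (let L = lacki_const N \<alpha> lam Lmin D in
      \<chi> j. 1 / 2 * Min ((\<lambda>(s, y). y $ j + L * N (x - s) powr \<alpha> + \<eta> x) ` D) +
           1 / 2 * Max ((\<lambda>(s, y). y $ j - L * N (x - s) powr \<alpha> - \<eta> x) ` D))"

(* Power with respect to the matrix product; the type class power operation on vectors
   is not the matrix power. *)
definition matrix_power :: "real ^ 'n ^ 'n \<Rightarrow> nat \<Rightarrow> real ^ 'n ^ 'n" where
  "matrix_power M i = ((\<lambda>A. M ** A) ^^ i) (mat 1)"

definition complex_eigenvalues :: "real ^ 'n ^ 'n \<Rightarrow> complex set" where
  "complex_eigenvalues M =
     {\<mu>. \<exists>v :: complex ^ 'n. v \<noteq> 0 \<and> map_matrix complex_of_real M *v v = \<mu> *s v}"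

definition real_spectral_radius :: "real ^ 'n ^ 'n \<Rightarrow> real" where
  "real_spectral_radius M = Max (cmod ` complex_eigenvalues M)"

(* onorm of the matrix action on Euclidean space is the spectral norm. *)
definition scaled_spectral_norm :: "real ^ 'n ^ 'n \<Rightarrow> real" where
  "scaled_spectral_norm A = sqrt (real CARD('n)) * onorm (\<lambda>v. A *v v)"

end

(* If L(n) stays bounded, the predictor at z differs from the observation at a nearby data
   point s by at most lam/2 + L(n) N(z - s)^alpha.  If L(n) is unbounded (possible when q = 0),
   it tends to infinity; the predictor always lies, componentwise, between two observations, one
   attaining the minimum and one the maximum in its definition, and L(n) -> infinity forces both
   of them to come from data points close to z.  A bounded trajectory returns arbitrarily close to
   the data set, so in either case limsup |F_n(x_n)| <= q/2 + 2 ebar, by continuity of f.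

   Stability of M is used without Jordan form: M is annihilated by a polynomial, and the orbit
   of a vector killed by p(M) is summable by induction on the degree of p, splitting off one
   root mu at a time.  If |mu| < 1, the orbit satisfies a contracting recurrence with summable
   input; otherwise M - mu is injective and the factor can be cancelled. *)
theory Submission
  imports Defs "HOL-Computational_Algebra.Fundamental_Theorem_Algebra"
begin

section \<open>Summability of the powers of a stable matrix\<close>

text \<open>The vector p(A) v, written through the orbit of \<open>v\<close> under \<open>A\<close>,
  so that polynomials act on vectors and no matrix polynomial has to be formed.\<close>

definition poly_op :: "complex poly \<Rightarrow> complex ^ 'n ^ 'n \<Rightarrow> complex ^ 'n \<Rightarrow> complex ^ 'n" where
  "poly_op p A v = (\<Sum>i\<le>degree p. coeff p i *s (((*v) A ^^ i) v))"

lemma poly_op_upto: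
  assumes "degree p \<le> n"
  shows "poly_op p A v = (\<Sum>i\<le>n. coeff p i *s (((*v) A ^^ i) v))"
  unfolding poly_op_def using assms
  by (intro sum.mono_neutral_left) (auto simp: coeff_eq_0)

lemma funpow_matrix_diff:
  fixes A :: "complex ^ 'n ^ 'n"
  shows "((*v) A ^^ i) (u - c *s v) = ((*v) A ^^ i) u - c *s (((*v) A ^^ i) v)"
  by (induction i) (simp_all add: matrix_vector_mult_diff_distrib vector_scalar_commute)

lemma poly_op_diff:
  "poly_op p A (u - c *s v) = poly_op p A u - c *s poly_op p A v"
  by (simp add: poly_op_def funpow_matrix_diff vec_eq_iff sum_subtractf sum_distrib_left
      algebra_simps)

lemma poly_op_matrix:
  "poly_op p A (A *v v) = A *v poly_op p A v"
  by (simp add: poly_op_def matrix_vector_right_distrib vec.linear_sum[OF matrix_vector_mul_linear_gen] funpow_swap1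
      vector_scalar_commute)

text \<open>Multiplying by X shifts the coefficients by one place, which on the orbit is one
  application of \<open>A\<close>. Splitting off a root thus replaces \<open>v\<close> by its image
  under A - \<mu>.\<close>

lemma poly_op_linear_factor:
  "poly_op ([:- \<mu>, 1:] * q) A v = poly_op q A (A *v v - \<mu> *s v)"
proof -
  let ?T = "\<lambda>i. ((*v) A ^^ i) v"
  have c: "coeff ([:- \<mu>, 1:] * q) i = coeff (pCons 0 q) i - \<mu> * coeff q i" for i
    by (simp add: mult_pCons_left)
  have deg: "degree ([:- \<mu>, 1:] * q) \<le> Suc (degree q)"
    by (rule order_trans[OF degree_mult_le]) simp
  have "poly_op ([:- \<mu>, 1:] * q) A v =
      (\<Sum>i\<le>Suc (degree q). coeff (pCons 0 q) i *s ?T i) - \<mu> *s (\<Sum>i\<le>Suc (degree q). coeff q i *s ?T i)"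
    unfolding poly_op_upto[OF deg] c
    by (simp add: vec_eq_iff sum_subtractf sum_distrib_left algebra_simps)
  also have "(\<Sum>i\<le>Suc (degree q). coeff (pCons 0 q) i *s ?T i) = poly_op q A (A *v v)"
    unfolding sum.atMost_Suc_shift poly_op_def by (simp add: funpow_swap1)
  also have "(\<Sum>i\<le>Suc (degree q). coeff q i *s ?T i) = poly_op q A v"
    by (rule poly_op_upto[symmetric]) simp
  finally show ?thesis by (simp add: poly_op_diff)
qed

lemma poly_op_eigenvector:
  assumes "A *v v = \<mu> *s v"
  shows "poly_op p A v = poly p \<mu> *s v"
proof -
  have "((*v) A ^^ i) v = \<mu> ^ i *s v" for i
    by (induction i) (simp_all add: assms vector_scalar_commute mult.commute)
  then show ?thesis
    by (simp add: poly_op_def poly_altdef vec_eq_iff sum_distrib_left ac_simps)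
qed

lemma sum_matrix_vector_mult:
  fixes B :: "'i \<Rightarrow> complex ^ 'n ^ 'n"
  shows "(\<Sum>i\<in>I. c i *\<^sub>R B i) *v v = (\<Sum>i\<in>I. complex_of_real (c i) *s (B i *v v))"
proof (induction I rule: infinite_finite_induct)
  case (insert a F)
  have "(c a *\<^sub>R B a) *v v = complex_of_real (c a) *s (B a *v v)"
    by (simp add: matrix_vector_mult_def vec_eq_iff sum_distrib_left mult.assoc
        scaleR_conv_of_real[where 'a = complex])
  with insert show ?case
    by (simp add: matrix_vector_mult_add_rdistrib)
qed simp_all

text \<open>The powers of \<open>A\<close> live in a finite-dimensional space, so they are linearly dependent.\<close>
lemma annihilating_poly:
  fixes A :: "complex ^ 'n ^ 'n"
  obtains p where "p \<noteq> 0" "\<And>v. poly_op p A v = 0"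
proof -
  define B where "B i = (((**) A) ^^ i) (mat 1)" for i
  have B: "B i *v v = ((*v) A ^^ i) v" for i v
    by (induction i) (simp_all add: B_def matrix_vector_mul_assoc[symmetric])
  \<comment> \<open>\<open>B 0\<close>, ..., \<open>B n\<close> are n + 1 matrices in a space of
    real dimension \<open>n\<close>. Either they are distinct, hence dependent, or two coincide, and
    their difference is the relation.\<close>
  define n where "n = DIM(complex ^ 'n ^ 'n)"
  obtain c :: "nat \<Rightarrow> real" where c: "\<exists>i\<le>n. c i \<noteq> 0" "(\<Sum>i\<le>n. c i *\<^sub>R B i) = 0"
  proof (cases "inj_on B {..n}")
    case True
    then have "card (B ` {..n}) > n" by (simp add: card_image)
    then have "dependent (B ` {..n})"
      unfolding n_def by (intro dependent_biggerset) auto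
    then obtain u where u: "\<exists>v\<in>B ` {..n}. u v \<noteq> 0" "(\<Sum>v\<in>B ` {..n}. u v *\<^sub>R v) = 0"
      by (subst (asm) dependent_finite) auto
    show thesis
      by (rule that[of "u \<circ> B"]) (use u True in \<open>auto simp: sum.reindex\<close>)
  next
    case False
    then obtain i j where ij: "i \<le> n" "j \<le> n" "i \<noteq> j" "B i = B j"
      by (auto simp: inj_on_def)
    let ?c = "\<lambda>k. if k = i then 1 else if k = j then - 1 else (0::real)"
    have "(\<Sum>k\<le>n. ?c k *\<^sub>R B k) = (\<Sum>k\<in>{i, j}. ?c k *\<^sub>R B k)"
      by (rule sum.mono_neutral_right) (use ij in auto)
    also have "\<dots> = 0" using ij by simp
    finally have "(\<Sum>k\<le>n. ?c k *\<^sub>R B k) = 0" .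
    moreover have "\<exists>k\<le>n. ?c k \<noteq> 0" using ij(1) by (intro exI[of _ i]) simp
    ultimately show thesis by (intro that[of ?c])
  qed
  define p where "p = (\<Sum>i\<le>n. monom (complex_of_real (c i)) i)"
  have coeff_p: "coeff p i = (if i \<le> n then complex_of_real (c i) else 0)" for i
    by (simp add: p_def coeff_sum)
  have "poly_op p A v = 0" for v
  proof -
    have "degree p \<le> n" by (rule degree_le) (simp add: coeff_p)
    then have "poly_op p A v = (\<Sum>i\<le>n. complex_of_real (c i) *s (B i *v v))"
      by (simp add: poly_op_upto coeff_p B)
    then show ?thesis by (simp add: sum_matrix_vector_mult[symmetric] c)
  qed
  moreover have "p \<noteq> 0"
    using c(1) coeff_p by (metis coeff_0 of_real_eq_0_iff)
  ultimately show thesis using that by blast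
qed

text \<open>Every eigenvalue is a root of an annihilating polynomial. Finiteness makes the
  \<open>Max\<close> in \<open>real_spectral_radius\<close> an actual upper bound.\<close>

lemma finite_eigenvalues:
  fixes A :: "complex ^ 'n ^ 'n"
  shows "finite {\<mu>. \<exists>v. v \<noteq> 0 \<and> A *v v = \<mu> *s v}"
proof -
  obtain p where p: "p \<noteq> 0" "\<And>v. poly_op p A v = 0"
    using annihilating_poly[of A] by metis
  have "poly p \<mu> = 0" if "v \<noteq> 0" "A *v v = \<mu> *s v" for \<mu> v
    using poly_op_eigenvector[OF that(2)] p(2) that(1) by (metis vector_mul_eq_0)
  then have "{\<mu>. \<exists>v. v \<noteq> 0 \<and> A *v v = \<mu> *s v} \<subseteq> {\<mu>. poly p \<mu> = 0}" by blast
  then show ?thesis by (rule finite_subset) (rule poly_roots_finite[OF p(1)])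
qed

text \<open>Summing the recurrence bounds the shifted partial sum of \<open>a\<close> by
  \<open>r\<close> times the partial sum plus the series of \<open>b\<close>. The shift costs at
  most \<open>a 0\<close>, and r < 1 allows solving for the partial sum.\<close>

lemma summable_of_affine_recurrence:
  fixes a b :: "nat \<Rightarrow> real"
  assumes "\<And>n. 0 \<le> a n" "\<And>n. 0 \<le> b n" "0 \<le> r" "r < 1" "summable b"
    and step: "\<And>n. a (Suc n) \<le> r * a n + b n"
  shows "summable a"
proof (rule summableI_nonneg_bounded[OF assms(1)])
  fix n
  have "(\<Sum>i<n. a (Suc i)) \<le> r * (\<Sum>i<n. a i) + (\<Sum>i<n. b i)"
    by (simp add: sum_distrib_left sum.distrib[symmetric] sum_mono step)
  moreover have "(\<Sum>i<n. b i) \<le> suminf b"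
    by (rule sum_le_suminf) (use assms in auto)
  moreover have "(\<Sum>i<n. a i) \<le> a 0 + (\<Sum>i<n. a (Suc i))"
    using sum.lessThan_Suc_shift[of a n] sum.lessThan_Suc[of a n] assms(1)[of n] by simp
  ultimately have "(1 - r) * (\<Sum>i<n. a i) \<le> a 0 + suminf b"
    by (simp add: algebra_simps)
  then show "(\<Sum>i<n. a i) \<le> (a 0 + suminf b) / (1 - r)"
    using assms(4) by (simp add: field_simps)
qed

lemma norm_vector_smult_complex: "norm (c *s v) = cmod c * norm (v :: complex ^ 'n)"
  by (simp add: norm_vec_def norm_mult L2_set_right_distrib)

lemma summable_norm_funpow_of_poly_op_eq_0:
  fixes A :: "complex ^ 'n ^ 'n"
  assumes stable: "\<And>\<mu> v. v \<noteq> 0 \<Longrightarrow> A *v v = \<mu> *s v \<Longrightarrow> cmod \<mu> < 1"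
    and "p \<noteq> 0" "poly_op p A v = 0"
  shows "summable (\<lambda>k. norm (((*v) A ^^ k) v))"
  using assms(2,3)
proof (induction "degree p" arbitrary: p v)
  case 0
  \<comment> \<open>A nonzero constant polynomial annihilates only the zero vector.\<close>
  then obtain c where "p = [:c:]" by (metis degree_eq_zeroE)
  with 0 have "v = 0" by (auto simp: poly_op_def)
  then have "((*v) A ^^ k) v = 0" for k by (induction k) auto
  then show ?case by simp
next
  case (Suc d)
  then obtain \<mu> where "poly p \<mu> = 0"
    using fundamental_theorem_of_algebra[of p] by (auto simp: constant_degree)
  then obtain q where p: "p = [:- \<mu>, 1:] * q" by (auto simp: poly_eq_0_iff_dvd)
  with Suc have q: "q \<noteq> 0" "degree q = d" by (auto simp: degree_mult_eq simp del: mult_pCons_left)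
  show ?case
  proof (cases "cmod \<mu> < 1")
    case True
    \<comment> \<open>Since p = (X - \<mu>) q, the vector w = (A - \<mu>) v is annihilated by
      \<open>q\<close> and has a summable orbit by induction. It is the input of the recurrence
      A^(k+1) v = \<mu> A^k v + A^k w.\<close>
    let ?w = "A *v v - \<mu> *s v"
    have w: "summable (\<lambda>k. norm (((*v) A ^^ k) ?w))"
      using Suc.prems Suc.hyps(1)[of q ?w] q by (simp add: p poly_op_linear_factor del: mult_pCons_left)
    have step: "norm (((*v) A ^^ Suc k) v) \<le> cmod \<mu> * norm (((*v) A ^^ k) v) + norm (((*v) A ^^ k) ?w)" for k
      using norm_triangle_ineq[of "\<mu> *s ((*v) A ^^ k) v" "((*v) A ^^ k) ?w"]
      by (simp add: funpow_matrix_diff norm_vector_smult_complex funpow_swap1)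
    show ?thesis
      by (rule summable_of_affine_recurrence[where b = "\<lambda>k. norm (((*v) A ^^ k) ?w)" and r = "cmod \<mu>"])
         (use True w step in simp_all)
  next
    case False
    \<comment> \<open>A - \<mu> sends q(A) v to p(A) v = 0, so a nonzero q(A) v would be an
      eigenvector for an eigenvalue of modulus at least 1. Hence \<open>q\<close> already
      annihilates \<open>v\<close>.\<close>
    have "A *v poly_op q A v = \<mu> *s poly_op q A v"
      using Suc.prems(2) by (simp add: p poly_op_linear_factor poly_op_diff poly_op_matrix del: mult_pCons_left)
    then have "poly_op q A v = 0" using stable False by blast
    then show ?thesis using Suc.hyps(1) q by blast
  qed
qed

section \<open>From complex orbits to the spectral norms of real matrix powers\<close>

lemma matrix_power_vector: "matrix_power M i *v v = ((*v) M ^^ i) v"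
  by (induction i) (simp_all add: matrix_power_def matrix_vector_mul_assoc[symmetric])

lemma scaled_spectral_norm_nonneg: "0 \<le> scaled_spectral_norm A"
  by (simp add: scaled_spectral_norm_def onorm_pos_le linear_conv_bounded_linear[symmetric])

text \<open>Complexification preserves the norms of real orbits, so each of them is summable. An
  operator norm is at most the sum of the norms of the images of the basis vectors, so finitely many
  orbits control the norms of all powers.\<close>

lemma summable_scaled_spectral_norm_power:
  fixes M :: "real ^ 'n ^ 'n"
  assumes "real_spectral_radius M < 1"
  shows "summable (\<lambda>i. scaled_spectral_norm (matrix_power M i))"
proof -
  let ?A = "map_matrix complex_of_real M"
  let ?c = "\<lambda>v :: real ^ 'n. \<chi> j. complex_of_real (v $ j)"
  have norm_c: "norm (?c v) = norm v" for v
    by (simp add: norm_vec_def)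
  have c: "((*v) ?A ^^ k) (?c v) = ?c (((*v) M ^^ k) v)" for k v
  proof (induction k)
    case (Suc k)
    then show ?case by (simp add: matrix_vector_mult_def vec_eq_iff)
  qed simp
  have fin: "finite (complex_eigenvalues M)"
    unfolding complex_eigenvalues_def by (rule finite_eigenvalues)
  have stable: "cmod \<mu> < 1" if "v \<noteq> 0" "?A *v v = \<mu> *s v" for \<mu> v
  proof -
    have "\<mu> \<in> complex_eigenvalues M" unfolding complex_eigenvalues_def using that by blast
    then have "cmod \<mu> \<le> real_spectral_radius M"
      unfolding real_spectral_radius_def using fin by simp
    with assms show ?thesis by simp
  qed
  have sum: "summable (\<lambda>k. norm (((*v) M ^^ k) v))" for v
  proof -
    obtain p where "p \<noteq> 0" "poly_op p ?A (?c v) = 0"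
      using annihilating_poly[of ?A] by metis
    then have "summable (\<lambda>k. norm (((*v) ?A ^^ k) (?c v)))"
      using stable summable_norm_funpow_of_poly_op_eq_0[of ?A p "?c v"] by metis
    then show ?thesis by (simp add: c norm_c)
  qed
  have on: "onorm ((*v) B) \<le> (\<Sum>b\<in>Basis. norm (B *v b))" for B :: "real ^ 'n ^ 'n"
  proof (rule onorm_le)
    fix v :: "real ^ 'n"
    have "B *v v = B *v (\<Sum>b\<in>Basis. (v \<bullet> b) *\<^sub>R b)" by (simp add: euclidean_representation)
    also have "\<dots> = (\<Sum>b\<in>Basis. (v \<bullet> b) *\<^sub>R (B *v b))"
      by (simp add: linear_sum[OF matrix_vector_mul_linear] matrix_vector_mult_scaleR)
    also have "norm \<dots> \<le> (\<Sum>b\<in>Basis. norm (B *v b) * norm v)"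
    proof (rule order_trans[OF norm_sum sum_mono])
      fix b :: "real ^ 'n" assume "b \<in> Basis"
      then show "norm ((v \<bullet> b) *\<^sub>R (B *v b)) \<le> norm (B *v b) * norm v"
        using Basis_le_norm[of b v] by (simp add: mult.commute mult_right_mono)
    qed
    finally show "norm (B *v v) \<le> (\<Sum>b\<in>Basis. norm (B *v b)) * norm v"
      by (simp add: sum_distrib_right)
  qed
  have "summable (\<lambda>i. onorm ((*v) (matrix_power M i)))"
  proof (rule summable_comparison_test)
    show "summable (\<lambda>i. \<Sum>b\<in>Basis. norm (matrix_power M i *v b))"
      by (intro summable_sum) (simp add: matrix_power_vector sum)
    show "\<exists>N. \<forall>n\<ge>N. norm (onorm ((*v) (matrix_power M n))) \<le> (\<Sum>b\<in>Basis. norm (matrix_power M n *v b))"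
      using on by (simp add: onorm_pos_le linear_conv_bounded_linear[symmetric])
  qed
  then show ?thesis by (simp add: scaled_spectral_norm_def summable_mult)
qed

section \<open>Linear recurrences driven by a bounded input\<close>

text \<open>The comparison infnorm <= norm <= sqrt d * infnorm is the source of the factor sqrt d in
  \<open>scaled_spectral_norm\<close>.\<close>

lemma infnorm_matrix_vector_mult_le:
  fixes A :: "real ^ 'n ^ 'n"
  shows "infnorm (A *v v) \<le> scaled_spectral_norm A * infnorm v"
proof -
  have bl: "bounded_linear ((*v) A)" by (simp add: linear_conv_bounded_linear[symmetric])
  have "infnorm (A *v v) \<le> norm (A *v v)" by (rule infnorm_le_norm)
  also have "\<dots> \<le> onorm ((*v) A) * norm v" by (rule onorm[OF bl])
  also have "\<dots> \<le> onorm ((*v) A) * (sqrt (real CARD('n)) * infnorm v)"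
    using norm_le_infnorm[of v] by (intro mult_left_mono onorm_pos_le bl) simp
  finally show ?thesis by (simp add: scaled_spectral_norm_def mult.assoc mult.left_commute)
qed

text \<open>Variation of constants from time \<open>m\<close>: index \<open>i\<close> carries the
  input applied i + 1 steps before time m + n. The induction peels off the first step, so the
  starting time stays arbitrary.\<close>

lemma linear_recurrence_solution:
  fixes M :: "real ^ 'n ^ 'n"
  assumes "\<And>n. e (Suc n) = M *v e n + \<Delta> *\<^sub>R w n"
  shows "e (m + n) = matrix_power M n *v e m +
    (\<Sum>i<n. \<Delta> *\<^sub>R (matrix_power M i *v w (m + n - Suc i)))"
proof (induction n arbitrary: m)
  case 0
  then show ?case by (simp add: matrix_power_def)
next
  case (Suc n)
  have "matrix_power M n *v e (Suc m) =
      matrix_power M (Suc n) *v e m + \<Delta> *\<^sub>R (matrix_power M n *v w m)"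
    by (simp add: assms matrix_vector_right_distrib matrix_vector_mult_scaleR)
       (simp add: matrix_power_vector funpow_swap1)
  then show ?case using Suc.IH[of "Suc m"] by simp
qed

lemma linear_recurrence_bound:
  fixes M :: "real ^ 'n ^ 'n"
  assumes rec: "\<And>n. e (Suc n) = M *v e n + \<Delta> *\<^sub>R w n"
    and "0 \<le> \<Delta>" "0 \<le> c" and w: "\<And>n. m \<le> n \<Longrightarrow> infnorm (w n) \<le> c"
    and s: "summable (\<lambda>i. scaled_spectral_norm (matrix_power M i))"
  shows "infnorm (e (m + n)) \<le> scaled_spectral_norm (matrix_power M n) * infnorm (e m) +
    \<Delta> * (\<Sum>i. scaled_spectral_norm (matrix_power M i)) * c"
proof -
  let ?s = "\<lambda>i. scaled_spectral_norm (matrix_power M i)"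
  have tri: "infnorm (\<Sum>i\<in>I. v i) \<le> (\<Sum>i\<in>I. infnorm (v i))" for v :: "nat \<Rightarrow> real ^ 'n" and I
  proof (induction I rule: infinite_finite_induct)
    case (insert i I)
    then show ?case using infnorm_triangle[of "v i" "sum v I"] by simp
  qed (simp_all add: infnorm_0)
  have "infnorm (\<Sum>i<n. \<Delta> *\<^sub>R (matrix_power M i *v w (m + n - Suc i))) \<le> (\<Sum>i<n. \<Delta> * (?s i * c))"
  proof (rule order_trans[OF tri sum_mono])
    fix i assume "i \<in> {..<n}"
    then have "infnorm (w (m + n - Suc i)) \<le> c" by (intro w) auto
    then have "infnorm (matrix_power M i *v w (m + n - Suc i)) \<le> ?s i * c"
      by (rule order_trans[OF infnorm_matrix_vector_mult_le mult_left_mono])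
         (rule scaled_spectral_norm_nonneg)
    then show "infnorm (\<Delta> *\<^sub>R (matrix_power M i *v w (m + n - Suc i))) \<le> \<Delta> * (?s i * c)"
      using \<open>0 \<le> \<Delta>\<close> by (simp add: infnorm_mul mult_left_mono)
  qed
  also have "\<dots> = \<Delta> * (\<Sum>i<n. ?s i) * c"
    by (simp add: sum_distrib_left sum_distrib_right mult.assoc)
  also have "\<dots> \<le> \<Delta> * (\<Sum>i. ?s i) * c"
    using \<open>0 \<le> \<Delta>\<close> \<open>0 \<le> c\<close> s
    by (intro mult_right_mono mult_left_mono sum_le_suminf) (auto simp: scaled_spectral_norm_nonneg)
  finally have "infnorm (\<Sum>i<n. \<Delta> *\<^sub>R (matrix_power M i *v w (m + n - Suc i))) \<le> \<Delta> * (\<Sum>i. ?s i) * c" .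
  then show ?thesis
    unfolding linear_recurrence_solution[where e = e and M = M, OF rec]
    by (intro order_trans[OF infnorm_triangle add_mono] infnorm_matrix_vector_mult_le)
qed

lemma converges_to_set_Icc_0:
  assumes "0 \<le> S" "\<And>n. 0 \<le> a n"
    and lim: "\<And>\<epsilon>. 0 < \<epsilon> \<Longrightarrow> \<forall>\<^sub>F n in sequentially. a n \<le> S + \<epsilon>"
  shows "converges_to_set a {0..S}"
  unfolding converges_to_set_def
proof (rule LIMSEQ_I)
  fix r :: real assume "r > 0"
  have bdd: "bdd_below ((\<lambda>y. \<bar>y - a n\<bar>) ` {0..S})" for n by (intro bdd_belowI[of _ 0]) auto
  have nonneg: "0 \<le> (INF y\<in>{0..S}. \<bar>y - a n\<bar>)" for n
    using \<open>0 \<le> S\<close> by (intro cINF_greatest) auto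
  \<comment> \<open>The infimum is tested at the point of the interval nearest to
    \<open>a n\<close>.\<close>
  have upper: "(INF y\<in>{0..S}. \<bar>y - a n\<bar>) \<le> \<bar>min (a n) S - a n\<bar>" for n
    using assms(1,2) by (intro cINF_lower bdd) auto
  obtain k where k: "\<And>n. n \<ge> k \<Longrightarrow> a n \<le> S + r / 2"
    using lim[of "r / 2"] \<open>r > 0\<close> by (auto simp: eventually_sequentially)
  have "norm ((INF y\<in>{0..S}. \<bar>y - a n\<bar>) - 0) < r" if "n \<ge> k" for n
    using nonneg[of n] upper[of n] k[OF that] \<open>r > 0\<close> by (simp add: min_def split: if_splits)
  then show "\<exists>k. \<forall>n\<ge>k. norm ((INF y\<in>{0..S}. \<bar>y - a n\<bar>) - 0) < r" by blast
qed

text \<open>Restarting at a late time leaves an input bounded by nearly \<beta> and an initial term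
  that dies out because the norms of the powers of \<open>M\<close> are summable.\<close>

lemma linear_recurrence_limsup:
  fixes M :: "real ^ 'n ^ 'n"
  assumes rec: "\<And>n. e (Suc n) = M *v e n + \<Delta> *\<^sub>R w n"
    and "0 \<le> \<Delta>" "0 \<le> \<beta>" and s: "summable (\<lambda>i. scaled_spectral_norm (matrix_power M i))"
    and w: "\<And>\<epsilon>. 0 < \<epsilon> \<Longrightarrow> \<forall>\<^sub>F n in sequentially. infnorm (w n) \<le> \<beta> + \<epsilon>"
    and "0 < \<epsilon>"
  shows "\<forall>\<^sub>F n in sequentially.
    infnorm (e n) \<le> \<Delta> * (\<Sum>i. scaled_spectral_norm (matrix_power M i)) * \<beta> + \<epsilon>"
proof -
  let ?s = "\<lambda>i. scaled_spectral_norm (matrix_power M i)"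
  define \<sigma> where "\<sigma> = \<Delta> * (\<Sum>i. ?s i)"
  have \<sigma>: "0 \<le> \<sigma>"
    unfolding \<sigma>_def using \<open>0 \<le> \<Delta>\<close> s by (simp add: suminf_nonneg scaled_spectral_norm_nonneg)
  \<comment> \<open>Half of \<epsilon> pays for the surplus input, half for the initial term; the
    \<open>+ 1\<close> keeps the quotient meaningful when \<sigma> = 0.\<close>
  define \<epsilon>' where "\<epsilon>' = \<epsilon> / (2 * (\<sigma> + 1))"
  have \<epsilon>': "0 < \<epsilon>'" "\<sigma> * \<epsilon>' \<le> \<epsilon> / 2"
    unfolding \<epsilon>'_def using \<sigma> \<open>0 < \<epsilon>\<close> by (simp_all add: field_simps)
  obtain m where m: "\<And>n. m \<le> n \<Longrightarrow> infnorm (w n) \<le> \<beta> + \<epsilon>'"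
    using w[OF \<epsilon>'(1)] by (auto simp: eventually_sequentially)
  have "(\<lambda>n. ?s n * infnorm (e m)) \<longlonglongrightarrow> 0"
    using tendsto_mult_left_zero[OF summable_LIMSEQ_zero[OF s]] .
  then have "\<forall>\<^sub>F n in sequentially. ?s n * infnorm (e m) < \<epsilon> / 2"
    using \<open>0 < \<epsilon>\<close> by (intro order_tendstoD(2)) auto
  then obtain k where k: "\<And>n. k \<le> n \<Longrightarrow> ?s n * infnorm (e m) < \<epsilon> / 2"
    by (auto simp: eventually_sequentially)
  have "infnorm (e n) \<le> \<sigma> * \<beta> + \<epsilon>" if "m + k \<le> n" for n
  proof -
    have "infnorm (e (m + (n - m))) \<le> ?s (n - m) * infnorm (e m) + \<sigma> * (\<beta> + \<epsilon>')"
      unfolding \<sigma>_def using \<open>0 \<le> \<Delta>\<close> \<open>0 \<le> \<beta>\<close> \<epsilon>'(1)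
      by (intro linear_recurrence_bound[where w = w and M = M and m = m and e = e, OF rec _ _ m s]) auto
    moreover have "?s (n - m) * infnorm (e m) < \<epsilon> / 2" using that by (intro k) simp
    ultimately show ?thesis using that \<epsilon>'(2) by (simp add: distrib_left)
  qed
  then show ?thesis unfolding \<sigma>_def eventually_sequentially by blast
qed

section \<open>Norms and bounded sequences\<close>

lemma is_norm_minus_commute: "is_norm N \<Longrightarrow> N (u - v) = N (v - u)"
  unfolding is_norm_def by (metis abs_minus_cancel abs_one minus_diff_eq mult_1 scaleR_minus1_left)

lemma is_norm_sum_le:
  assumes "is_norm N"
  shows "N (\<Sum>i\<in>I. v i) \<le> (\<Sum>i\<in>I. N (v i))"
proof (induction I rule: infinite_finite_induct)
  case (insert i I)
  have "N (v i + sum v I) \<le> N (v i) + N (sum v I)"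
    using assms by (simp add: is_norm_def)
  with insert show ?case by simp
qed (use assms in \<open>simp_all add: is_norm_def order_eq_refl\<close>)

lemma is_norm_upper_bound:
  fixes N :: "'a::euclidean_space \<Rightarrow> real"
  assumes N: "is_norm N"
  obtains C where "C > 0" "\<And>v. N v \<le> C * norm v"
proof
  have pos: "0 \<le> N b" for b using N by (simp add: is_norm_def)
  show "1 + (\<Sum>b\<in>Basis. N b) > (0::real)"
    using sum_nonneg[of Basis N] pos by (simp add: add_pos_nonneg)
  fix v :: 'a
  have "N v = N (\<Sum>b\<in>Basis. (v \<bullet> b) *\<^sub>R b)" by (simp add: euclidean_representation)
  also have "\<dots> \<le> (\<Sum>b\<in>Basis. N ((v \<bullet> b) *\<^sub>R b))" by (rule is_norm_sum_le[OF N])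
  also have "\<dots> = (\<Sum>b\<in>Basis. \<bar>v \<bullet> b\<bar> * N b)" using N by (simp add: is_norm_def)
  also have "\<dots> \<le> (\<Sum>b\<in>Basis. norm v * N b)"
    by (intro sum_mono mult_right_mono Basis_le_norm pos)
  also have "\<dots> \<le> (1 + (\<Sum>b\<in>Basis. N b)) * norm v"
    by (simp add: sum_distrib_left[symmetric] mult.commute[of _ "norm v"] mult_left_mono)
  finally show "N v \<le> (1 + (\<Sum>b\<in>Basis. N b)) * norm v" .
qed

text \<open>A norm is convex, and a convex function on an open subset of a finite-dimensional space
  is continuous.\<close>

lemma is_norm_continuous:
  fixes N :: "'a::euclidean_space \<Rightarrow> real"
  assumes N: "is_norm N"
  shows "continuous_on UNIV N"
proof (intro convex_on_continuous convex_onI)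
  fix t :: real and u v :: 'a
  assume "0 < t" "t < 1"
  moreover have "N ((1 - t) *\<^sub>R u + t *\<^sub>R v) \<le> N ((1 - t) *\<^sub>R u) + N (t *\<^sub>R v)"
    "N ((1 - t) *\<^sub>R u) = \<bar>1 - t\<bar> * N u" "N (t *\<^sub>R v) = \<bar>t\<bar> * N v"
    using N unfolding is_norm_def by blast+
  ultimately show "N ((1 - t) *\<^sub>R u + t *\<^sub>R v) \<le> (1 - t) * N u + t * N v" by simp
qed auto

text \<open>\<open>N\<close> attains a positive minimum on the compact Euclidean unit sphere; by
  homogeneity its inverse is the constant.\<close>

lemma is_norm_lower_bound:
  fixes N :: "'a::euclidean_space \<Rightarrow> real"
  assumes N: "is_norm N"
  obtains c where "c > 0" "\<And>v. norm v \<le> c * N v"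
proof -
  have "sphere (0::'a) 1 \<noteq> {}"
    using SOME_Basis norm_Basis by fastforce
  then obtain u where u: "u \<in> sphere 0 1" "\<And>v. v \<in> sphere (0::'a) 1 \<Longrightarrow> N u \<le> N v"
    using continuous_attains_inf[OF compact_sphere _ continuous_on_subset[OF is_norm_continuous[OF N]]]
    by blast
  have "u \<noteq> 0" using u(1) by auto
  then have pos: "N u > 0" using N unfolding is_norm_def by (metis less_eq_real_def)
  have "norm v \<le> inverse (N u) * N v" for v
  proof (cases "v = 0")
    case False
    then have "N u \<le> N ((1 / norm v) *\<^sub>R v)" by (intro u(2)) simp
    also have "\<dots> = N v / norm v" using N by (simp add: is_norm_def)
    finally show ?thesis using False pos by (simp add: field_simps)
  qed (use pos N in \<open>simp add: is_norm_def\<close>)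
  then show thesis using pos that[of "inverse (N u)"] by simp
qed

text \<open>For t in [0, 1] one has \<open>t \<le> t powr \<alpha>\<close>; this is applied to the
  two shares a / (a + b) and b / (a + b). As a consequence \<open>N\<close> raised to the power
  \<alpha> still satisfies the triangle inequality.\<close>

lemma powr_subadditive:
  fixes a b \<alpha> :: real
  assumes "0 \<le> a" "0 \<le> b" "0 < \<alpha>" "\<alpha> \<le> 1"
  shows "(a + b) powr \<alpha> \<le> a powr \<alpha> + b powr \<alpha>"
proof (cases "a + b = 0")
  case False
  have *: "t * (a + b) powr \<alpha> \<le> (t * (a + b)) powr \<alpha>" if "0 \<le> t" "t \<le> 1" for t
  proof -
    have "t \<le> t powr \<alpha>" using powr_mono'[of \<alpha> 1 t] assms that by simp
    then show ?thesis using assms that by (simp add: powr_mult mult_right_mono)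
  qed
  have "(a + b) powr \<alpha> = (a / (a + b)) * (a + b) powr \<alpha> + (b / (a + b)) * (a + b) powr \<alpha>"
    using False by (simp add: distrib_right[symmetric] add_divide_distrib[symmetric])
  also have "\<dots> \<le> a powr \<alpha> + b powr \<alpha>"
    using *[of "a / (a + b)"] *[of "b / (a + b)"] assms False by (intro add_mono) simp_all
  finally show ?thesis .
qed (use assms in simp)

lemma powr_small:
  fixes B \<alpha> \<epsilon> :: real
  assumes "0 < \<alpha>" "0 < \<epsilon>" "0 \<le> B"
  obtains \<delta> where "\<delta> > 0" "\<And>t. 0 \<le> t \<Longrightarrow> t < \<delta> \<Longrightarrow> B * t powr \<alpha> \<le> \<epsilon>"
proof
  \<comment> \<open>\<open>B + 1\<close> in place of \<open>B\<close> avoids a division by zero when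
    B = 0.\<close>
  let ?\<delta> = "(\<epsilon> / (B + 1)) powr (1 / \<alpha>)"
  show "?\<delta> > 0" using assms by simp
  fix t assume t: "0 \<le> t" "t < ?\<delta>"
  then have "t powr \<alpha> \<le> ?\<delta> powr \<alpha>" using assms by (intro powr_mono2) auto
  also have "\<dots> = \<epsilon> / (B + 1)" using assms by (simp add: powr_powr)
  finally have "(B + 1) * t powr \<alpha> \<le> \<epsilon>" using assms by (simp add: field_simps)
  then show "B * t powr \<alpha> \<le> \<epsilon>" by (simp add: distrib_right) (smt (verit) powr_ge_zero)
qed

text \<open>Finitely many balls of radius \<delta> / 2 cover the sequence. Once every ball that is
  ever met has had its first visit, each new term shares a ball with an earlier one.\<close>

lemma bounded_sequence_revisits:
  fixes x :: "nat \<Rightarrow> 'a::euclidean_space"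
  assumes "bounded (range x)" "\<delta> > 0"
  shows "\<forall>\<^sub>F n in sequentially. \<exists>m<n. dist (x n) (x m) < \<delta>"
proof -
  have "compact (closure (range x))" using assms(1) by (simp add: compact_closure)
  then obtain k where k: "finite k" "closure (range x) \<subseteq> (\<Union>c\<in>k. ball c (\<delta> / 2))"
    using compact_eq_totally_bounded[of "closure (range x)"] assms(2) half_gt_zero by metis
  \<comment> \<open>For a ball that the sequence never meets the value is unspecified; it can only
    raise the threshold \<open>Max\<close>.\<close>
  define first where "first c = (LEAST m. x m \<in> ball c (\<delta> / 2))" for c
  have "\<exists>m<n. dist (x n) (x m) < \<delta>" if n: "n > Max (insert 0 (first ` k))" for n
  proof -
    have "x n \<in> closure (range x)" by (rule subsetD[OF closure_subset]) simp
    then obtain c where c: "c \<in> k" "x n \<in> ball c (\<delta> / 2)" using k(2) by blast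
    have "x (first c) \<in> ball c (\<delta> / 2)" using c(2) unfolding first_def by (rule LeastI)
    with c(2) have "dist (x n) (x (first c)) < \<delta>"
      using dist_triangle_half_r[of c "x n" \<delta> "x (first c)"] by simp
    moreover have "first c \<le> Max (insert 0 (first ` k))" using k(1) c(1) by simp
    ultimately show ?thesis using n by (meson le_less_trans)
  qed
  then show ?thesis by (auto simp: eventually_at_top_dense)
qed

lemma infnorm_le_componentwise:
  fixes v :: "real ^ 'n"
  assumes "\<And>j. \<bar>v $ j\<bar> \<le> c"
  shows "infnorm v \<le> c"
  unfolding infnorm_cart using assms by (intro cSup_least) auto

section \<open>The prediction error along a bounded trajectory\<close>

text \<open>The shift \<open>c\<close> does not move the points where the extrema are attained, and
  it enters the two halves with opposite signs, so it cancels.\<close>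

lemma midrange_attained:
  fixes g h :: "'i \<Rightarrow> real"
  assumes I: "finite I" "I \<noteq> {}"
  obtains a b where "a \<in> I" "b \<in> I"
    "\<forall>i\<in>I. g a + h a \<le> g i + h i" "\<forall>i\<in>I. g i - h i \<le> g b - h b"
    "1 / 2 * Min ((\<lambda>i. g i + h i + c) ` I) + 1 / 2 * Max ((\<lambda>i. g i - h i - c) ` I) =
       (g a + h a + (g b - h b)) / 2"
proof -
  have "Min ((\<lambda>i. g i + h i + c) ` I) \<in> (\<lambda>i. g i + h i + c) ` I" using I by (intro Min_in) auto
  then obtain a where a: "a \<in> I" "Min ((\<lambda>i. g i + h i + c) ` I) = g a + h a + c" by blast
  have "Max ((\<lambda>i. g i - h i - c) ` I) \<in> (\<lambda>i. g i - h i - c) ` I" using I by (intro Max_in) auto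
  then obtain b where b: "b \<in> I" "Max ((\<lambda>i. g i - h i - c) ` I) = g b - h b - c" by blast
  show thesis
  proof (rule that[OF a(1) b(1)])
    show "\<forall>i\<in>I. g a + h a \<le> g i + h i"
    proof
      fix i assume i: "i \<in> I"
      have "Min ((\<lambda>i. g i + h i + c) ` I) \<le> g i + h i + c" using I i by (intro Min_le) auto
      then show "g a + h a \<le> g i + h i" using a by simp
    qed
    show "\<forall>i\<in>I. g i - h i \<le> g b - h b"
    proof
      fix i assume i: "i \<in> I"
      have "g i - h i - c \<le> Max ((\<lambda>i. g i - h i - c) ` I)" using I i by (intro Max_ge) auto
      then show "g i - h i \<le> g b - h b" using b by simp
    qed
  qed (unfold a(2) b(2), argo)
qed

lemma lacki_predictor_attained:
  fixes D :: "((real ^ 'n) \<times> (real ^ 'n)) set"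
    and N :: "real ^ 'n \<Rightarrow> real" and z :: "real ^ 'n" and \<alpha> lam Lmin :: real
  assumes "finite D" "D \<noteq> {}"
  defines "h \<equiv> \<lambda>p. lacki_const N \<alpha> lam Lmin D * N (z - fst p) powr \<alpha>"
  obtains a b where "a \<in> D" "b \<in> D"
    "\<forall>p\<in>D. snd a $ j + h a \<le> snd p $ j + h p"
    "\<forall>p\<in>D. snd p $ j - h p \<le> snd b $ j - h b"
    "lacki_predictor N \<alpha> lam Lmin \<eta> D z $ j = (snd a $ j + h a + (snd b $ j - h b)) / 2"
proof -
  let ?g = "\<lambda>p :: (real ^ 'n) \<times> (real ^ 'n). snd p $ j"
  have eq: "lacki_predictor N \<alpha> lam Lmin \<eta> D z $ j =
      1 / 2 * Min ((\<lambda>p. ?g p + h p + \<eta> z) ` D) + 1 / 2 * Max ((\<lambda>p. ?g p - h p - \<eta> z) ` D)"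
    by (simp add: lacki_predictor_def Let_def h_def case_prod_beta')
  show thesis
    by (rule midrange_attained[OF assms(1,2), where g = ?g and h = h and c = "\<eta> z"])
       (rule that, simp_all add: eq)
qed

text \<open>Both extremal data points satisfy the inequality assumed in \<open>near\<close> by their
  optimality, so both observations are within \<open>r\<close> of \<open>w\<close>, and the
  prediction lies between these two observations.\<close>

lemma lacki_predictor_between:
  fixes D :: "((real ^ 'n) \<times> (real ^ 'n)) set"
  assumes D: "finite D" "D \<noteq> {}"
    and near: "\<And>p. p \<in> D \<Longrightarrow>
      (\<And>p'. p' \<in> D \<Longrightarrow> lacki_const N \<alpha> lam Lmin D * N (z - fst p) powr \<alpha> \<le>
        \<bar>snd p' $ j - snd p $ j\<bar> + lacki_const N \<alpha> lam Lmin D * N (z - fst p') powr \<alpha>) \<Longrightarrow>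
      \<bar>snd p $ j - w\<bar> \<le> r"
  shows "\<bar>lacki_predictor N \<alpha> lam Lmin \<eta> D z $ j - w\<bar> \<le> r"
proof -
  let ?h = "\<lambda>p. lacki_const N \<alpha> lam Lmin D * N (z - fst p) powr \<alpha>"
  obtain a b where ab: "a \<in> D" "b \<in> D"
    and a: "\<forall>p\<in>D. snd a $ j + ?h a \<le> snd p $ j + ?h p"
    and b: "\<forall>p\<in>D. snd p $ j - ?h p \<le> snd b $ j - ?h b"
    and eq: "lacki_predictor N \<alpha> lam Lmin \<eta> D z $ j = (snd a $ j + ?h a + (snd b $ j - ?h b)) / 2"
    by (rule lacki_predictor_attained[OF D,
      where N = N and \<alpha> = \<alpha> and lam = lam and Lmin = Lmin and \<eta> = \<eta> and z = z and j = j])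
  have "\<bar>snd a $ j - w\<bar> \<le> r"
    by (rule near[OF ab(1)]) (use a in \<open>smt (verit)\<close>)
  moreover have "\<bar>snd b $ j - w\<bar> \<le> r"
    by (rule near[OF ab(2)]) (use b in \<open>smt (verit)\<close>)
  \<comment> \<open>Testing the maximality of \<open>b\<close> at \<open>a\<close>, and then the
    minimality of \<open>a\<close> at \<open>b\<close>, cancels the distance terms.\<close>
  moreover have "snd a $ j \<le> (snd a $ j + ?h a + (snd b $ j - ?h b)) / 2"
    using bspec[OF b ab(1)] by argo
  moreover have "(snd a $ j + ?h a + (snd b $ j - ?h b)) / 2 \<le> snd b $ j"
    using bspec[OF a ab(2)] by argo
  ultimately show ?thesis unfolding eq by argo
qed

section \<open>The LACKI constant and the prediction near a data point\<close>

lemma lacki_const_finite: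
  assumes "finite D"
  shows "finite {(infnorm (y - y') - lam) / N (s - s') powr \<alpha> | s y s' y'.
    (s, y) \<in> D \<and> (s', y') \<in> D \<and> N (s - s') > 0}"
proof (rule finite_subset)
  show "finite ((\<lambda>((s, y), (s', y')). (infnorm (y - y') - lam) / N (s - s') powr \<alpha>) ` (D \<times> D))"
    using assms by simp
qed force

lemma lacki_const_ge_Lmin: "finite D \<Longrightarrow> Lmin \<le> lacki_const N \<alpha> lam Lmin D"
  unfolding lacki_const_def by (intro Max_ge) (auto simp: lacki_const_finite)

lemma lacki_const_mono:
  assumes "D \<subseteq> D'" "finite D'"
  shows "lacki_const N \<alpha> lam Lmin D \<le> lacki_const N \<alpha> lam Lmin D'"
  unfolding lacki_const_def
proof (intro Max_mono insert_mono)
  show "finite (insert Lmin {(infnorm (y - y') - lam) / N (s - s') powr \<alpha> | s y s' y'.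
    (s, y) \<in> D' \<and> (s', y') \<in> D' \<and> N (s - s') > 0})"
    using assms(2) by (simp add: lacki_const_finite)
qed (use assms(1) in blast)+

lemma lacki_const_data_diff:
  assumes "finite D" "(s, y) \<in> D" "(s', y') \<in> D" "N (s - s') > 0"
  shows "infnorm (y - y') \<le> lam + lacki_const N \<alpha> lam Lmin D * N (s - s') powr \<alpha>"
proof -
  have "(infnorm (y - y') - lam) / N (s - s') powr \<alpha> \<le> lacki_const N \<alpha> lam Lmin D"
    unfolding lacki_const_def using assms by (intro Max_ge) (auto simp: lacki_const_finite)
  then show ?thesis using assms(4) by (simp add: field_simps)
qed

text \<open>Each of the two extremal terms is bounded on one side by its optimality tested at
  \<open>p\<close>, which costs only the distance term of \<open>p\<close>, and on the other side by
  \<open>diff\<close>, which costs an additional \<open>lam\<close>. Averaging halves this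
  \<open>lam\<close>.\<close>

lemma lacki_predictor_near_data:
  fixes D :: "((real ^ 'n) \<times> (real ^ 'n)) set"
  assumes N: "is_norm N" and \<alpha>: "0 < \<alpha>" "\<alpha> \<le> 1" and "0 \<le> Lmin" "0 \<le> lam"
    and D: "finite D" "\<And>s y. (s, y) \<in> D \<Longrightarrow> y = g s" and p: "p \<in> D"
  shows "\<bar>lacki_predictor N \<alpha> lam Lmin \<eta> D z $ j - snd p $ j\<bar> \<le>
    lam / 2 + lacki_const N \<alpha> lam Lmin D * N (z - fst p) powr \<alpha>"
proof -
  define L where "L = lacki_const N \<alpha> lam Lmin D"
  have L: "0 \<le> L" using lacki_const_ge_Lmin[OF D(1)] assms(4) unfolding L_def by (rule order_trans[rotated])
  have nonneg: "0 \<le> N v" for v using N by (simp add: is_norm_def)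
  have diff: "\<bar>snd p $ j - snd p' $ j\<bar> \<le> lam + L * N (z - fst p) powr \<alpha> + L * N (z - fst p') powr \<alpha>"
    if p': "p' \<in> D" for p'
  proof (cases "fst p = fst p'")
    \<comment> \<open>The constant controls only pairs at positive distance; at equal inputs the
      observations agree because the data lie on the graph of \<open>g\<close>.\<close>
    case True
    then have "snd p = snd p'" using D(2) p p' by (metis prod.collapse)
    then show ?thesis using L \<open>0 \<le> lam\<close> by simp
  next
    case False
    then have "N (fst p - fst p') > 0" using N unfolding is_norm_def by (metis eq_iff_diff_eq_0 less_eq_real_def)
    then have "infnorm (snd p - snd p') \<le> lam + L * N (fst p - fst p') powr \<alpha>"
      unfolding L_def using D(1) p p' by (intro lacki_const_data_diff) auto
    moreover have "N (fst p - fst p') powr \<alpha> \<le> N (z - fst p) powr \<alpha> + N (z - fst p') powr \<alpha>"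
    proof -
      have "N ((fst p - z) + (z - fst p')) \<le> N (fst p - z) + N (z - fst p')"
        using N unfolding is_norm_def by blast
      then have "N (fst p - fst p') \<le> N (z - fst p) + N (z - fst p')"
        by (simp add: is_norm_minus_commute[OF N, of "fst p" z])
      then have "N (fst p - fst p') powr \<alpha> \<le> (N (z - fst p) + N (z - fst p')) powr \<alpha>"
        using nonneg \<alpha> by (intro powr_mono2) auto
      also have "\<dots> \<le> N (z - fst p) powr \<alpha> + N (z - fst p') powr \<alpha>"
        using nonneg \<alpha> by (intro powr_subadditive)
      finally show ?thesis .
    qed
    then have "L * N (fst p - fst p') powr \<alpha> \<le> L * N (z - fst p) powr \<alpha> + L * N (z - fst p') powr \<alpha>"
      using L by (simp add: distrib_left[symmetric] mult_left_mono)
    ultimately show ?thesis using component_le_infnorm_cart[of "snd p - snd p'" j] by simp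
  qed
  have "D \<noteq> {}" using p by blast
  then obtain a b where ab: "a \<in> D" "b \<in> D"
    and a: "\<forall>p\<in>D. snd a $ j + L * N (z - fst a) powr \<alpha> \<le> snd p $ j + L * N (z - fst p) powr \<alpha>"
    and b: "\<forall>p\<in>D. snd p $ j - L * N (z - fst p) powr \<alpha> \<le> snd b $ j - L * N (z - fst b) powr \<alpha>"
    and eq: "lacki_predictor N \<alpha> lam Lmin \<eta> D z $ j =
      (snd a $ j + L * N (z - fst a) powr \<alpha> + (snd b $ j - L * N (z - fst b) powr \<alpha>)) / 2"
    unfolding L_def by (rule lacki_predictor_attained[OF D(1),
      where N = N and \<alpha> = \<alpha> and lam = lam and Lmin = Lmin and \<eta> = \<eta> and z = z and j = j])
  show ?thesis
    unfolding eq L_def[symmetric] using bspec[OF a p] bspec[OF b p] diff[OF ab(1)] diff[OF ab(2)] by argo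
qed

lemma lacki_prediction_error_limsup:
  fixes x :: "nat \<Rightarrow> real ^ 'n" and f g :: "real ^ 'n \<Rightarrow> real ^ 'n"
    and D :: "nat \<Rightarrow> ((real ^ 'n) \<times> (real ^ 'n)) set"
  assumes N: "is_norm N" and \<alpha>: "0 < \<alpha>" "\<alpha> \<le> 1" and Lmin: "0 \<le> Lmin"
    and f: "continuous_on UNIV f" and obs: "\<And>z. infnorm (g z - f z) \<le> ebar"
    and lam: "q \<ge> 0" "lam = 2 * ebar + q"
    and D0: "finite (D 0)" "\<And>s y. (s, y) \<in> D 0 \<Longrightarrow> y = g s"
    and DS: "\<And>n. D (Suc n) = D n \<union> {(x n, g (x n))}"
    and x: "bounded (range x)" and "\<epsilon> > 0"
  shows "\<forall>\<^sub>F n in sequentially.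
    infnorm (f (x n) - lacki_predictor N \<alpha> lam Lmin \<eta> (D n) (x n)) \<le> q / 2 + 2 * ebar + \<epsilon>"
proof -
  define L where "L n = lacki_const N \<alpha> lam Lmin (D n)" for n
  \<comment> \<open>A compact set containing the trajectory and all data inputs; on it
    \<open>f\<close> is bounded and uniformly continuous.\<close>
  define K where "K = closure (range x \<union> fst ` D 0)"
  have ebar: "0 \<le> ebar" using obs infnorm_pos_le order_trans by blast
  have nonneg: "0 \<le> N v" for v using N by (simp add: is_norm_def)
  have fin: "finite (D n)" for n by (induction n) (simp_all add: D0 DS)
  have graph: "y = g s" if "(s, y) \<in> D n" for n s y
    using that by (induction n) (auto simp: D0 DS)
  have x_in_K: "x n \<in> K" for n
    unfolding K_def by (rule subsetD[OF closure_subset]) simp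
  have in_K: "fst p \<in> K" if "p \<in> D n" for p n
  proof -
    have "fst p \<in> range x \<union> fst ` D 0" using that by (induction n) (auto simp: DS)
    then show ?thesis unfolding K_def by (rule subsetD[OF closure_subset])
  qed
  have visited: "(x m, g (x m)) \<in> D n" if "m < n" for m n
    using that by (induction n) (auto simp: DS less_Suc_eq)
  have K: "compact K" unfolding K_def compact_closure using x D0(1)
    by (simp add: finite_imp_bounded)
  have fK: "continuous_on K f" using f by (rule continuous_on_subset) simp
  \<comment> \<open>Uniform continuity of \<open>f\<close> on \<open>K\<close>, restated in the
    input metric; comparison with the Euclidean norm rescales \<delta>.\<close>
  have unif: "\<exists>\<delta>>0. \<forall>s\<in>K. \<forall>t\<in>K. N (s - t) < \<delta> \<longrightarrow> infnorm (f s - f t) \<le> r" if "r > 0" for r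
  proof -
    obtain c where c: "c > 0" "\<And>v. norm v \<le> c * N v" using is_norm_lower_bound[OF N] by metis
    obtain \<delta> where \<delta>: "\<delta> > 0" "\<And>s t. s \<in> K \<Longrightarrow> t \<in> K \<Longrightarrow> dist t s < \<delta> \<Longrightarrow> dist (f t) (f s) < r"
      using compact_uniformly_continuous[OF fK K] \<open>r > 0\<close>
      unfolding uniformly_continuous_on_def by metis
    have "infnorm (f s - f t) \<le> r" if "s \<in> K" "t \<in> K" "N (s - t) < \<delta> / c" for s t
    proof -
      have "c * N (s - t) < \<delta>" using that(3) c(1) by (simp add: field_simps)
      then have "dist s t < \<delta>" using c(2)[of "s - t"] by (simp add: dist_norm)
      then have "norm (f s - f t) < r" using \<delta>(2) that by (simp add: dist_norm)
      then show ?thesis using infnorm_le_norm[of "f s - f t"] by simp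
    qed
    then show ?thesis using \<delta>(1) c(1) by (intro exI[of _ "\<delta> / c"]) simp
  qed
  have near: "\<forall>\<^sub>F n in sequentially. \<exists>p\<in>D n. N (x n - fst p) < \<delta>" if "\<delta> > 0" for \<delta>
  proof -
    obtain C where C: "C > 0" "\<And>v. N v \<le> C * norm v" using is_norm_upper_bound[OF N] by metis
    \<comment> \<open>Earlier states are data inputs, so a revisit by the trajectory yields a nearby
      data point.\<close>
    have "\<forall>\<^sub>F n in sequentially. \<exists>m<n. dist (x n) (x m) < \<delta> / C"
      using that C(1) by (intro bounded_sequence_revisits x) simp
    then show ?thesis
    proof eventually_elim
      case (elim n)
      then obtain m where m: "m < n" "dist (x n) (x m) < \<delta> / C" by blast
      then have "C * norm (x n - x m) < \<delta>" using C(1) by (simp add: dist_norm field_simps)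
      then have "N (x n - x m) < \<delta>" using C(2)[of "x n - x m"] by simp
      then show ?case using visited[OF m(1)] by force
    qed
  qed
  have mono: "L n \<le> L m" if "n \<le> m" for n m
  proof -
    have "D n \<subseteq> D m" by (rule lift_Suc_mono_le[OF _ that]) (auto simp: DS)
    then show ?thesis unfolding L_def using fin by (intro lacki_const_mono)
  qed
  have L_nonneg: "0 \<le> L n" for n
    using lacki_const_ge_Lmin[OF fin] Lmin unfolding L_def by (rule order_trans[rotated])
  have comp: "\<bar>snd p $ j - f z $ j\<bar> \<le> ebar + infnorm (f (fst p) - f z)" if "p \<in> D n" for p n z j
  proof -
    have "snd p = g (fst p)" using graph that by (metis prod.collapse)
    then show ?thesis
      using component_le_infnorm_cart[of "g (fst p) - f (fst p)" j] obs[of "fst p"]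
        component_le_infnorm_cart[of "f (fst p) - f z" j] by simp
  qed
  have "\<forall>\<^sub>F n in sequentially. \<forall>j.
    \<bar>lacki_predictor N \<alpha> lam Lmin \<eta> (D n) (x n) $ j - f (x n) $ j\<bar> \<le> q / 2 + 2 * ebar + \<epsilon>"
  \<comment> \<open>\<open>L\<close> is nondecreasing, so it is either bounded or eventually above
    every threshold.\<close>
  proof (cases "\<exists>B. \<forall>n. L n \<le> B")
    case True
    then obtain B where B: "\<And>n. L n \<le> B" by blast
    have "0 \<le> B" using order_trans[OF L_nonneg[of 0] B[of 0]] .
    then obtain \<delta>1 where \<delta>1: "\<delta>1 > 0" "\<And>t. 0 \<le> t \<Longrightarrow> t < \<delta>1 \<Longrightarrow> B * t powr \<alpha> \<le> \<epsilon> / 2"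
      using powr_small[OF \<alpha>(1), of "\<epsilon> / 2" B] \<open>\<epsilon> > 0\<close> by auto
    obtain \<delta>2 where \<delta>2: "\<delta>2 > 0"
      "\<And>s t. s \<in> K \<Longrightarrow> t \<in> K \<Longrightarrow> N (s - t) < \<delta>2 \<Longrightarrow> infnorm (f s - f t) \<le> \<epsilon> / 2"
      using unif[of "\<epsilon> / 2"] \<open>\<epsilon> > 0\<close> by auto
    have "\<forall>\<^sub>F n in sequentially. \<exists>p\<in>D n. N (x n - fst p) < min \<delta>1 \<delta>2"
      using \<delta>1 \<delta>2 by (intro near) simp
    then show ?thesis
    proof eventually_elim
      case (elim n)
      then obtain p where p: "p \<in> D n" "N (x n - fst p) < \<delta>1" "N (x n - fst p) < \<delta>2" by auto
      have f_near: "infnorm (f (fst p) - f (x n)) \<le> \<epsilon> / 2"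
        using \<delta>2(2)[OF x_in_K in_K[OF p(1)] p(3)] by (simp add: infnorm_sub)
      have L_small: "L n * N (x n - fst p) powr \<alpha> \<le> \<epsilon> / 2"
        using \<delta>1(2)[OF nonneg p(2)] mult_right_mono[OF B[of n] powr_ge_zero] by (rule order_trans[rotated])
      have pred: "\<bar>lacki_predictor N \<alpha> lam Lmin \<eta> (D n) (x n) $ j - snd p $ j\<bar> \<le>
          lam / 2 + L n * N (x n - fst p) powr \<alpha>" for j
        unfolding L_def using ebar lam
        by (intro lacki_predictor_near_data[OF N \<alpha> Lmin _ fin graph p(1)]) auto
      \<comment> \<open>\<open>lam / 2\<close> equals q / 2 + ebar, passing from the observation to
        \<open>f\<close> costs another \<open>ebar\<close>, and the two halves of \<epsilon> cover
        the distance term and the variation of \<open>f\<close>.\<close>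
      have "\<bar>lacki_predictor N \<alpha> lam Lmin \<eta> (D n) (x n) $ j - f (x n) $ j\<bar> \<le>
          q / 2 + 2 * ebar + \<epsilon>" for j
        using comp[OF p(1), of j "x n"] lam(2) pred[of j] f_near L_small by argo
      then show ?case by blast
    qed
  next
    case False
    obtain \<delta> where \<delta>: "\<delta> > 0"
      "\<And>s t. s \<in> K \<Longrightarrow> t \<in> K \<Longrightarrow> N (s - t) < \<delta> \<Longrightarrow> infnorm (f s - f t) \<le> \<epsilon>"
      using unif[OF \<open>\<epsilon> > 0\<close>] by blast
    obtain \<delta>' where \<delta>': "\<delta>' > 0" "\<And>t. 0 \<le> t \<Longrightarrow> t < \<delta>' \<Longrightarrow> t powr \<alpha> \<le> \<delta> powr \<alpha> / 3"
      using powr_small[OF \<alpha>(1), of "\<delta> powr \<alpha> / 3" 1] \<delta>(1) by auto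
    obtain b where b: "\<And>s. s \<in> K \<Longrightarrow> norm (f s) \<le> b"
      using compact_imp_bounded[OF compact_continuous_image[OF fK K]] by (auto simp: bounded_iff)
    have data: "\<bar>snd p $ j\<bar> \<le> b + ebar" if "p \<in> D n" for p n j
      using comp[OF that, of j "fst p"] b[OF in_K[OF that]] component_le_norm_cart[of "f (fst p)" j]
      by (simp add: infnorm_0)
    \<comment> \<open>Two observations differ by at most 2 (|b| + ebar) in each component; past this
      threshold that is less than a third of \<open>L n * \<delta> powr \<alpha>\<close>. The
      absolute value makes the threshold nonnegative, hence \<open>L n\<close> positive.\<close>
    obtain m where m: "L m > 6 * (\<bar>b\<bar> + ebar) / \<delta> powr \<alpha>" using False by (meson not_le)
    have "\<forall>\<^sub>F n in sequentially. \<exists>p\<in>D n. N (x n - fst p) < \<delta>'" by (rule near[OF \<delta>'(1)])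
    moreover have "\<forall>\<^sub>F n in sequentially. m \<le> n" by (rule eventually_ge_at_top)
    ultimately show ?thesis
    proof eventually_elim
      case (elim n)
      then obtain i where i: "i \<in> D n" "N (x n - fst i) < \<delta>'" by blast
      then have i': "N (x n - fst i) powr \<alpha> \<le> \<delta> powr \<alpha> / 3" using \<delta>' nonneg by blast
      have Ln: "L n > 6 * (\<bar>b\<bar> + ebar) / \<delta> powr \<alpha>" using m mono elim by (meson less_le_trans)
      then have Ln0: "L n > 0" using ebar \<delta>(1) by (smt (verit) divide_nonneg_nonneg powr_ge_zero)
      show ?case
      proof
        fix j
        have "\<bar>snd p $ j - f (x n) $ j\<bar> \<le> ebar + \<epsilon>"
          if p: "p \<in> D n" and le: "\<And>p'. p' \<in> D n \<Longrightarrow> L n * N (x n - fst p) powr \<alpha> \<le>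
            \<bar>snd p' $ j - snd p $ j\<bar> + L n * N (x n - fst p') powr \<alpha>" for p
        proof -
          \<comment> \<open>Comparison with the nearby data point \<open>i\<close>: the gap between
            the observations and the distance term of \<open>i\<close> each take at most a third of
            \<open>L n * \<delta> powr \<alpha>\<close>, which forces \<open>p\<close> to within
            \<delta> of the state.\<close>
          have "L n * N (x n - fst p) powr \<alpha> \<le> 2 * (\<bar>b\<bar> + ebar) + L n * (\<delta> powr \<alpha> / 3)"
            using le[OF i(1)] data[OF i(1), of j] data[OF p, of j] mult_left_mono[OF i' L_nonneg[of n]]
            by argo
          also have "\<dots> < L n * (\<delta> powr \<alpha> / 3) + L n * (\<delta> powr \<alpha> / 3)"
            using Ln \<delta>(1) by (simp add: field_simps)
          also have "\<dots> < L n * \<delta> powr \<alpha>" using Ln0 \<delta>(1) by (simp add: field_simps)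
          finally have "N (x n - fst p) powr \<alpha> < \<delta> powr \<alpha>" using Ln0 by simp
          then have "N (x n - fst p) < \<delta>"
            using powr_mono2[of \<alpha> \<delta> "N (x n - fst p)"] \<alpha>(1) \<delta>(1) by force
          then have "infnorm (f (fst p) - f (x n)) \<le> \<epsilon>"
            using \<delta>(2)[OF x_in_K in_K[OF p]] by (simp add: infnorm_sub)
          then show ?thesis using comp[OF p, of j "x n"] by simp
        qed
        then have "\<bar>lacki_predictor N \<alpha> lam Lmin \<eta> (D n) (x n) $ j - f (x n) $ j\<bar> \<le> ebar + \<epsilon>"
          using fin i(1) unfolding L_def by (intro lacki_predictor_between) auto
        then show "\<bar>lacki_predictor N \<alpha> lam Lmin \<eta> (D n) (x n) $ j - f (x n) $ j\<bar> \<le> q / 2 + 2 * ebar + \<epsilon>"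
          using ebar lam(1) by simp
      qed
    qed
  qed
  then show ?thesis
  proof eventually_elim
    case (elim n)
    show ?case
    proof (rule infnorm_le_componentwise)
      fix j
      show "\<bar>(f (x n) - lacki_predictor N \<alpha> lam Lmin \<eta> (D n) (x n)) $ j\<bar> \<le> q / 2 + 2 * ebar + \<epsilon>"
        using elim[rule_format, of j] by (simp add: abs_minus_commute)
    qed
  qed
qed

section \<open>Boundedness of the trajectory and the resulting tracking bound\<close>

theorem theorem3p4:
  fixes M :: "real ^ 'n ^ 'n"
    and N :: "real ^ 'n \<Rightarrow> real"
    and f f_obs :: "real ^ 'n \<Rightarrow> real ^ 'n"
    and \<eta> :: "real ^ 'n \<Rightarrow> real"
    and D :: "nat \<Rightarrow> ((real ^ 'n) \<times> (real ^ 'n)) set"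
    and F :: "nat \<Rightarrow> real ^ 'n \<Rightarrow> real ^ 'n"
    and x \<xi> e :: "nat \<Rightarrow> real ^ 'n"
    and \<Delta> \<alpha> Lstar Lmin Eh ebar q lam \<sigma> :: real
  assumes "is_norm N"
    and "\<Delta> > 0"
    and "0 < \<alpha>" and "\<alpha> \<le> 1"
    and "0 \<le> Lmin"
    and "\<And>z. 0 \<le> \<eta> z"
    and "continuous_on UNIV f"
    and "0 \<le> Eh"
    and "holder_up_to_error N Lstar \<alpha> Eh f"
    and "\<And>z. infnorm (f_obs z - f z) \<le> ebar"
    and "q \<ge> 0" and "lam = 2 * ebar + q"
    and "finite (D 0)" and "D 0 \<noteq> {}" and "\<And>s y. (s, y) \<in> D 0 \<Longrightarrow> y = f_obs s"
    and "\<And>n. D (Suc n) = D n \<union> {(x n, f_obs (x n))}"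
    and "\<And>n z. F n z = f z - lacki_predictor N \<alpha> lam Lmin \<eta> (D n) z"
    and "\<And>n. e n = \<xi> n - x n"
    and "\<And>n. e (Suc n) = M *v e n + \<Delta> *\<^sub>R F n (x n)"
    and "bounded (range (\<lambda>n. F n (x n)))"
    and "bounded (range \<xi>)"
    and "\<exists>b. \<forall>z. infnorm (F 0 z) \<le> b"
    and "real_spectral_radius M < 1"
    and "\<sigma> = \<Delta> * (\<Sum>i. scaled_spectral_norm (matrix_power M i))"
  shows "summable (\<lambda>i. scaled_spectral_norm (matrix_power M i)) \<and>
         converges_to_set (\<lambda>n. infnorm (e n)) {0 .. \<sigma> * (q / 2 + 2 * ebar + 2 * Eh)}"
proof
  let ?s = "\<lambda>i. scaled_spectral_norm (matrix_power M i)"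
  define w where "w n = F n (x n)" for n
  have rec: "e (Suc n) = M *v e n + \<Delta> *\<^sub>R w n" for n
    unfolding w_def by (rule assms(19))
  show s: "summable ?s" using assms(23) by (rule summable_scaled_spectral_norm_power)
  have \<sigma>: "0 \<le> \<sigma>"
    unfolding assms(24) using \<open>\<Delta> > 0\<close> s by (simp add: suminf_nonneg scaled_spectral_norm_nonneg)
  have ebar: "0 \<le> ebar" using order_trans[OF infnorm_pos_le assms(10)] .
  obtain B where "\<And>n. norm (w n) \<le> B"
    using assms(20) unfolding w_def by (auto simp: bounded_iff)
  then have B: "infnorm (w n) \<le> B" for n using order_trans[OF infnorm_le_norm] by blast
  have "0 \<le> B" using order_trans[OF infnorm_pos_le B[of 0]] .
  \<comment> \<open>A crude bound from the bounded input, started at time 0. Together with the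
    bounded reference it makes the trajectory bounded, as the prediction error estimate
    requires.\<close>
  have "infnorm (e n) \<le> suminf ?s * infnorm (e 0) + \<Delta> * suminf ?s * B" for n
  proof -
    have "infnorm (e (0 + n)) \<le> ?s n * infnorm (e 0) + \<Delta> * suminf ?s * B"
      using \<open>\<Delta> > 0\<close> \<open>0 \<le> B\<close>
      by (intro linear_recurrence_bound[where w = w and M = M and m = 0 and e = e, OF rec _ _ B s]) auto
    moreover have "?s n \<le> suminf ?s"
      using sum_le_suminf[OF s, of "{n}"] by (simp add: scaled_spectral_norm_nonneg)
    then have "?s n * infnorm (e 0) \<le> suminf ?s * infnorm (e 0)"
      by (rule mult_right_mono) (rule infnorm_pos_le)
    ultimately show ?thesis by simp
  qed
  then have "norm (e n) \<le> sqrt DIM(real ^ 'n) * (suminf ?s * infnorm (e 0) + \<Delta> * suminf ?s * B)" for n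
    by (intro order_trans[OF norm_le_infnorm] mult_left_mono) auto
  then have "bounded (range e)" by (auto simp: bounded_iff)
  then have x: "bounded (range x)"
    using bounded_minus_comp[OF assms(21), of e] by (simp add: assms(18))
  define \<beta> where "\<beta> = q / 2 + 2 * ebar"
  have \<beta>: "0 \<le> \<beta>" unfolding \<beta>_def using ebar \<open>q \<ge> 0\<close> by simp
  have w: "\<forall>\<^sub>F n in sequentially. infnorm (w n) \<le> \<beta> + \<epsilon>" if "0 < \<epsilon>" for \<epsilon>
    unfolding w_def assms(17) \<beta>_def
    by (rule lacki_prediction_error_limsup[OF assms(1,3-5,7,10-13,15,16) x that])
  show "converges_to_set (\<lambda>n. infnorm (e n)) {0 .. \<sigma> * (q / 2 + 2 * ebar + 2 * Eh)}"
  proof (rule converges_to_set_Icc_0)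
    show "0 \<le> \<sigma> * (q / 2 + 2 * ebar + 2 * Eh)"
      using \<sigma> \<beta> \<open>0 \<le> Eh\<close> unfolding \<beta>_def by simp
    show "0 \<le> infnorm (e n)" for n by (rule infnorm_pos_le)
    fix \<epsilon> :: real assume "0 < \<epsilon>"
    have "\<forall>\<^sub>F n in sequentially. infnorm (e n) \<le> \<sigma> * \<beta> + \<epsilon>"
      unfolding assms(24)
      by (rule linear_recurrence_limsup[where w = w and M = M and e = e, OF rec less_imp_le[OF \<open>\<Delta> > 0\<close>] \<beta> s w \<open>0 < \<epsilon>\<close>])
    \<comment> \<open>Since \<sigma> and \<open>Eh\<close> are nonnegative, the interval of the
      conclusion contains the one ending at \<open>\<sigma> * \<beta>\<close>.\<close>
    moreover have "\<sigma> * \<beta> \<le> \<sigma> * (q / 2 + 2 * ebar + 2 * Eh)"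
      unfolding \<beta>_def using \<sigma> \<open>0 \<le> Eh\<close> by (intro mult_left_mono) auto
    ultimately show "\<forall>\<^sub>F n in sequentially. infnorm (e n) \<le> \<sigma> * (q / 2 + 2 * ebar + 2 * Eh) + \<epsilon>"
      by (auto elim: eventually_mono)
  qed
qed

end
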